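(* The only rays in the Macdonald tree are $\{(n)\}_{n\ge0}$ and $\{(1^n)\}_{n\ge0}$ (i.e. the ray of one-row partitions and the ray of one-column partitions).
   Context: For a partition $\lambda$, $f_\lambda$ is the number of standard Young tableaux of shape $\lambda$; $\lambda$ is odd if $f_\lambda$ is odd. The Macdonald tree is the subgraph induced in Young's graph (Hasse diagram of partitions ordered by containment) by the odd partitions; it is a rooted tree with root $\emptyset$. A ray in the Macdonald tree is a sequence $(\lambda^{(n)})_{n\ge0}$ of odd partitions with $\lambda^{(0)}=\emptyset$ and $\lambda^{(n+1)}$ covering $\lambda^{(n)}$ (obtained from it by adding one cell) for all $n$. *)

theory Defs
  imports Complex_Main "HOL-Library.FuncSet"
begin

text \<open>Partitions are lists of positive parts in weakly decreasing order, so that the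
  empty partition is the empty list. Rows and columns of diagrams are indexed from 0.\<close>

definition is_partition :: "nat list \<Rightarrow> bool" where
  "is_partition \<mu> \<longleftrightarrow> sorted_wrt (\<ge>) \<mu> \<and> (\<forall>k\<in>set \<mu>. 0 < k)"

definition young_diagram :: "nat list \<Rightarrow> (nat \<times> nat) set" where
  "young_diagram \<mu> = {(i, j). i < length \<mu> \<and> j < \<mu> ! i}"

text \<open>Fillings are taken extensional, so that each tableau of shape \<open>\<mu>\<close> is represented
  by exactly one function.\<close>

definition standard_tableaux :: "nat list \<Rightarrow> (nat \<times> nat \<Rightarrow> nat) set" where
  "standard_tableaux \<mu> =
     {T \<in> extensional (young_diagram \<mu>).
        bij_betw T (young_diagram \<mu>) {1..sum_list \<mu>} \<and>
        (\<forall>i j. (i, Suc j) \<in> young_diagram \<mu> \<longrightarrow> T (i, j) < T (i, Suc j)) \<and>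
        (\<forall>i j. (Suc i, j) \<in> young_diagram \<mu> \<longrightarrow> T (i, j) < T (Suc i, j))}"

definition num_syt :: "nat list \<Rightarrow> nat" where
  "num_syt \<mu> = card (standard_tableaux \<mu>)"

definition odd_partition :: "nat list \<Rightarrow> bool" where
  "odd_partition \<mu> \<longleftrightarrow> is_partition \<mu> \<and> odd (num_syt \<mu>)"

definition young_covers :: "nat list \<Rightarrow> nat list \<Rightarrow> bool" where
  "young_covers \<nu> \<mu> \<longleftrightarrow> is_partition \<nu> \<and> is_partition \<mu> \<and>
     (\<exists>c. c \<notin> young_diagram \<mu> \<and> young_diagram \<nu> = insert c (young_diagram \<mu>))"

definition macdonald_ray :: "(nat \<Rightarrow> nat list) \<Rightarrow> bool" where
  "macdonald_ray r \<longleftrightarrow> r 0 = [] \<and> (\<forall>n. odd_partition (r n)) \<and>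
     (\<forall>n. young_covers (r (Suc n)) (r n))"

definition one_row :: "nat \<Rightarrow> nat list" where
  "one_row n = (if n = 0 then [] else [n])"

definition one_column :: "nat \<Rightarrow> nat list" where
  "one_column n = replicate n 1"

end

theory Submission
  imports Defs "HOL-Library.Z2"
begin

text \<open>Encode a partition by its beads \<open>\<lambda>\<^sub>i - i\<close>, \<open>i \<ge> 0\<close>; removing a corner moves one bead down by one
  onto a free place. Let \<open>D\<^sub>h\<close> send a function on bead configurations, with values in the field with
  two elements, to the sum of its values over all moves of one bead by \<open>h\<close>. Then
  \<open>D\<^sub>h \<circ> D\<^sub>h = D\<^bsub>2h\<^esub>\<close>, so the parity of \<open>f\<^sub>\<lambda>\<close> for \<open>|\<lambda>| = 2\<^sup>k + m\<close> is computed by one move by \<open>2\<^sup>k\<close>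
  followed by \<open>m\<close> unit moves to the empty partition. For \<open>m = 0\<close> this forces an odd partition to
  avoid the cell \<open>(1, 1)\<close>, so a ray consists of hooks; for \<open>m = 1\<close> it shows that an odd
  hook with \<open>2\<^sup>k + 1\<close> cells is a row or a column. Since \<open>k\<close> is arbitrary and diagrams grow along a
  ray, this holds along the whole ray.\<close>

section \<open>Removing the largest entry of a tableau\<close>

definition lower_diagram :: "(nat \<times> nat) set \<Rightarrow> bool" where
  "lower_diagram D \<longleftrightarrow> finite D \<and>
     (\<forall>i j. (i, Suc j) \<in> D \<longrightarrow> (i, j) \<in> D) \<and> (\<forall>i j. (Suc i, j) \<in> D \<longrightarrow> (i, j) \<in> D)"

text \<open>The shape is given by its cells instead of a list of parts, so that deleting a corner is
  a plain set difference.\<close>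

definition diagram_tableaux :: "(nat \<times> nat) set \<Rightarrow> (nat \<times> nat \<Rightarrow> nat) set" where
  "diagram_tableaux D =
     {T \<in> extensional D. bij_betw T D {1..card D} \<and>
        (\<forall>i j. (i, Suc j) \<in> D \<longrightarrow> T (i, j) < T (i, Suc j)) \<and>
        (\<forall>i j. (Suc i, j) \<in> D \<longrightarrow> T (i, j) < T (Suc i, j))}"

definition corners :: "(nat \<times> nat) set \<Rightarrow> (nat \<times> nat) set" where
  "corners D = {(i, j) \<in> D. (i, Suc j) \<notin> D \<and> (Suc i, j) \<notin> D}"

lemma finite_diagram_tableaux:
  assumes "finite D"
  shows "finite (diagram_tableaux D)"
proof (rule finite_subset)
  show "diagram_tableaux D \<subseteq> D \<rightarrow>\<^sub>E {1..card D}"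
    by (auto simp: diagram_tableaux_def PiE_def dest: bij_betwE)
  show "finite (D \<rightarrow>\<^sub>E {1..card D})"
    using assms by (intro finite_PiE) auto
qed

lemma diagram_tableaux_empty: "diagram_tableaux {} = {\<lambda>_. undefined}"
  by (auto simp: diagram_tableaux_def bij_betw_def)

text \<open>A cell to the right or below would have to hold an entry above
  \<open>card D\<close>.\<close>

lemma largest_entry_at_corner:
  assumes "T \<in> diagram_tableaux D" "c \<in> D" "T c = card D"
  shows "c \<in> corners D"
proof -
  obtain i j where c: "c = (i, j)" by (cases c)
  have le: "T d \<le> card D" if "d \<in> D" for d
    using assms(1) that by (auto simp: diagram_tableaux_def dest!: bij_betwE)
  have "T (i, j) < T (i, Suc j)" if "(i, Suc j) \<in> D"
    using assms(1) that by (simp add: diagram_tableaux_def)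
  then have "(i, Suc j) \<notin> D" using assms(3) le[of "(i, Suc j)"] c by force
  moreover have "T (i, j) < T (Suc i, j)" if "(Suc i, j) \<in> D"
    using assms(1) that by (simp add: diagram_tableaux_def)
  then have "(Suc i, j) \<notin> D" using assms(3) le[of "(Suc i, j)"] c by force
  ultimately show ?thesis using assms(2) by (simp add: corners_def c)
qed

text \<open>The inverse writes \<open>card D\<close> back into \<open>c\<close>. A corner is neither
  the left nor the upper neighbour of a cell of \<open>D\<close>, so the new entry only has to
  exceed its neighbours, and it exceeds all other entries.\<close>

lemma remove_largest_entry:
  assumes D: "lower_diagram D" and c: "c \<in> corners D"
  shows "bij_betw (\<lambda>T. restrict T (D - {c})) {T \<in> diagram_tableaux D. T c = card D}
           (diagram_tableaux (D - {c}))"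
proof -
  have fin: "finite D" using D by (simp add: lower_diagram_def)
  have cD: "c \<in> D" using c by (cases c) (simp add: corners_def)
  define n where "n = card (D - {c})"
  have cardD: "card D = Suc n"
    using card_Suc_Diff1[OF fin cD] by (simp only: n_def)
  have ins: "(D - {c}) \<union> {c} = D" using cD by auto
  have right: "(i, j) \<in> D - {c}" if "(i, Suc j) \<in> D" for i j
  proof -
    have "(i, j) \<in> D" using that D unfolding lower_diagram_def by blast
    moreover have "c \<noteq> (i, j)" using that c by (auto simp: corners_def)
    ultimately show ?thesis by simp
  qed
  have below: "(i, j) \<in> D - {c}" if "(Suc i, j) \<in> D" for i j
  proof -
    have "(i, j) \<in> D" using that D unfolding lower_diagram_def by blast
    moreover have "c \<noteq> (i, j)" using that c by (auto simp: corners_def)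
    ultimately show ?thesis by simp
  qed
  show ?thesis
  proof (rule bij_betw_byWitness[where f' = "\<lambda>U. U(c := card D)"])
    show "\<forall>T\<in>{T \<in> diagram_tableaux D. T c = card D}. (restrict T (D - {c}))(c := card D) = T"
      by (auto simp: diagram_tableaux_def extensional_def fun_eq_iff restrict_def)
    show "\<forall>U\<in>diagram_tableaux (D - {c}). restrict (U(c := card D)) (D - {c}) = U"
      by (auto simp: diagram_tableaux_def extensional_def fun_eq_iff restrict_def)
    show "(\<lambda>T. restrict T (D - {c})) ` {T \<in> diagram_tableaux D. T c = card D}
            \<subseteq> diagram_tableaux (D - {c})"
    proof (rule image_subsetI)
      fix T assume "T \<in> {T \<in> diagram_tableaux D. T c = card D}"
      then have T: "T \<in> diagram_tableaux D" "T c = card D" by simp_all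
      have "bij_betw T D {1..card D}" using T by (simp add: diagram_tableaux_def)
      then have "bij_betw T (D - {c}) ({1..card D} - {card D})"
        using bij_betw_DiffI[of T D "{1..card D}" "{c}" "{card D}"] T(2) cD by (auto simp: cardD)
      also have "{1..card D} - {card D} = {1..n}" using cardD by auto
      finally have "bij_betw (restrict T (D - {c})) (D - {c}) {1..n}"
        by (subst bij_betw_cong[where g = T]) auto
      moreover have "restrict T (D - {c}) (i, j) < restrict T (D - {c}) (i, Suc j)"
        if "(i, Suc j) \<in> D - {c}" for i j
        using that right[of i j] T(1) by (simp add: diagram_tableaux_def)
      moreover have "restrict T (D - {c}) (i, j) < restrict T (D - {c}) (Suc i, j)"
        if "(Suc i, j) \<in> D - {c}" for i j
        using that below[of i j] T(1) by (simp add: diagram_tableaux_def)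
      ultimately show "restrict T (D - {c}) \<in> diagram_tableaux (D - {c})"
        unfolding diagram_tableaux_def n_def by blast
    qed
    show "(\<lambda>U. U(c := card D)) ` diagram_tableaux (D - {c})
            \<subseteq> {T \<in> diagram_tableaux D. T c = card D}"
    proof (rule image_subsetI)
      fix U assume U: "U \<in> diagram_tableaux (D - {c})"
      then have bij: "bij_betw U (D - {c}) {1..n}"
        unfolding n_def diagram_tableaux_def by blast
      then have le: "U d < card D" if "d \<in> D - {c}" for d
        using bij_betw_apply[OF _ that] unfolding cardD by fastforce
      have "bij_betw (U(c := card D)) (D - {c}) {1..n}"
        using bij by (subst bij_betw_cong[where g = U]) auto
      then have "bij_betw (U(c := card D)) ((D - {c}) \<union> {c})
                   ({1..n} \<union> {(U(c := card D)) c})"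
        by (rule notIn_Un_bij_betw[rotated 2]) (simp_all add: cardD)
      also have "{1..n} \<union> {(U(c := card D)) c} = {1..card D}"
        by (auto simp: cardD)
      finally have "bij_betw (U(c := card D)) D {1..card D}" by (simp only: ins)
      moreover have "(U(c := card D)) (i, j) < (U(c := card D)) (i, Suc j)"
        if "(i, Suc j) \<in> D" for i j
      proof (cases "c = (i, Suc j)")
        case False
        then show ?thesis using right[OF that] U that by (simp add: diagram_tableaux_def)
      qed (use right[OF that] le in auto)
      moreover have "(U(c := card D)) (i, j) < (U(c := card D)) (Suc i, j)"
        if "(Suc i, j) \<in> D" for i j
      proof (cases "c = (Suc i, j)")
        case False
        then show ?thesis using below[OF that] U that by (simp add: diagram_tableaux_def)
      qed (use below[OF that] le in auto)
      moreover have "U(c := card D) \<in> extensional D"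
        using U cD by (auto simp: diagram_tableaux_def extensional_def)
      ultimately show "U(c := card D) \<in> {T \<in> diagram_tableaux D. T c = card D}"
        unfolding diagram_tableaux_def by simp
    qed
  qed
qed

text \<open>Branching rule: tableaux are sorted by the corner that holds their largest
  entry.\<close>

lemma card_diagram_tableaux:
  assumes D: "lower_diagram D" and ne: "D \<noteq> {}"
  shows "card (diagram_tableaux D) = (\<Sum>c\<in>corners D. card (diagram_tableaux (D - {c})))"
proof -
  have fin: "finite D" using D by (simp add: lower_diagram_def)
  have sub: "corners D \<subseteq> D" by (auto simp: corners_def)
  have pos: "card D \<ge> 1" using fin ne by (simp add: Suc_le_eq card_gt_0_iff)
  have "diagram_tableaux D = (\<Union>c\<in>corners D. {T \<in> diagram_tableaux D. T c = card D})"
  proof (intro equalityI subsetI)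
    fix T assume T: "T \<in> diagram_tableaux D"
    then have "card D \<in> T ` D" using pos by (auto simp: diagram_tableaux_def bij_betw_def)
    then obtain c where "c \<in> D" "T c = card D" by force
    with T largest_entry_at_corner[OF T, of c]
    show "T \<in> (\<Union>c\<in>corners D. {T \<in> diagram_tableaux D. T c = card D})" by blast
  qed auto
  then have "card (diagram_tableaux D) =
      card (\<Union>c\<in>corners D. {T \<in> diagram_tableaux D. T c = card D})"
    by simp
  also have "\<dots> = (\<Sum>c\<in>corners D. card {T \<in> diagram_tableaux D. T c = card D})"
  proof (rule card_UN_disjoint)
    show "finite (corners D)" using fin sub finite_subset by blast
    show "\<forall>c\<in>corners D. finite {T \<in> diagram_tableaux D. T c = card D}"
      using finite_diagram_tableaux[OF fin] by auto
    show "\<forall>c\<in>corners D. \<forall>d\<in>corners D. c \<noteq> d \<longrightarrow>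
        {T \<in> diagram_tableaux D. T c = card D} \<inter> {T \<in> diagram_tableaux D. T d = card D} = {}"
    proof (intro ballI impI equals0I)
      fix c d T
      assume cd: "c \<in> corners D" "d \<in> corners D" "c \<noteq> d"
        and T: "T \<in> {T \<in> diagram_tableaux D. T c = card D} \<inter> {T \<in> diagram_tableaux D. T d = card D}"
      then have "inj_on T D" by (auto simp: diagram_tableaux_def bij_betw_def)
      then have "c = d" by (rule inj_onD) (use cd T sub in auto)
      then show False using cd by simp
    qed
  qed
  also have "\<dots> = (\<Sum>c\<in>corners D. card (diagram_tableaux (D - {c})))"
    by (intro sum.cong refl bij_betw_same_card[OF remove_largest_entry[OF D]])
  finally show ?thesis .
qed

section \<open>Moving beads of Maya diagrams over the field with two elements\<close>

text \<open>All low places are occupied and all high ones free. This leaves only finitely many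
  movable beads, so that the sum in \<open>bead_step\<close> is a genuine finite one.\<close>

definition maya :: "int set \<Rightarrow> bool" where
  "maya S \<longleftrightarrow> (\<exists>a b. {..a} \<subseteq> S \<and> S \<subseteq> {..b})"

definition move_bead :: "int \<Rightarrow> int \<Rightarrow> int set \<Rightarrow> int set" where
  "move_bead h x S = insert (x - h) (S - {x})"

definition movable :: "int \<Rightarrow> int set \<Rightarrow> int set" where
  "movable h S = {x \<in> S. x - h \<notin> S}"

text \<open>On partitions, moving a bead by \<open>h\<close> removes a rim hook of length
  \<open>h\<close>; this is the Murnaghan-Nakayama rule, whose signs vanish mod 2.\<close>

definition bead_step :: "int \<Rightarrow> (int set \<Rightarrow> bit) \<Rightarrow> int set \<Rightarrow> bit" where
  "bead_step h \<phi> S = (\<Sum>x\<in>movable h S. \<phi> (move_bead h x S))"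

lemma finite_movable:
  assumes "maya S"
  shows "finite (movable h S)"
proof -
  obtain a b where "{..a} \<subseteq> S" "S \<subseteq> {..b}" using assms by (auto simp: maya_def)
  then have "movable h S \<subseteq> {a + h..b}"
    by (auto simp: movable_def subset_iff intro: ccontr)
  then show ?thesis by (rule finite_subset) simp
qed

lemma maya_move_bead:
  assumes "maya S"
  shows "maya (move_bead h x S)"
proof -
  obtain a b where "{..a} \<subseteq> S" "S \<subseteq> {..b}" using assms by (auto simp: maya_def)
  then have "{..min a (x - 1)} \<subseteq> move_bead h x S" "move_bead h x S \<subseteq> {..max b (x - h)}"
    by (force simp: move_bead_def)+
  then show ?thesis unfolding maya_def by blast
qed

text \<open>Swapping coordinates matches the pairs with \<open>x < y\<close> to those with
  \<open>y < x\<close>, and two equal sums cancel in characteristic two.\<close>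

lemma sum_symmetric_pairs_bit:
  fixes f :: "'a :: linorder \<Rightarrow> 'a \<Rightarrow> bit"
  assumes "finite A" "\<And>x y. f x y = f y x"
  shows "(\<Sum>(x, y)\<in>{(x, y). x \<in> A \<and> y \<in> A \<and> x \<noteq> y}. f x y) = 0"
proof -
  let ?L = "{(x, y). x \<in> A \<and> y \<in> A \<and> x < y}"
  let ?G = "{(x, y). x \<in> A \<and> y \<in> A \<and> y < x}"
  have fin: "finite ?L" "finite ?G"
    by (rule finite_subset[of _ "A \<times> A"]; use assms(1) in auto)+
  have "{(x, y). x \<in> A \<and> y \<in> A \<and> x \<noteq> y} = ?L \<union> ?G" by auto
  moreover have "?L \<inter> ?G = {}" by auto
  moreover have "(\<Sum>(x, y)\<in>?L. f x y) = (\<Sum>(x, y)\<in>?G. f x y)"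
    by (rule sum.reindex_bij_witness[of _ "\<lambda>(x, y). (y, x)" "\<lambda>(x, y). (y, x)"])
       (auto simp: assms(2))
  ultimately show ?thesis using fin by (simp add: sum.union_disjoint)
qed

text \<open>Two different beads that can both move cancel against the opposite order of moves; what
  remains is one bead moved twice, or a bead moved onto the place just vacated by another.\<close>

lemma bead_step_twice:
  assumes S: "maya S" and h: "h > 0"
  shows "bead_step h (bead_step h \<phi>) S = bead_step (2 * h) \<phi> S"
proof -
  define A where "A = movable h S"
  define F where "F = (\<lambda>x y. \<phi> (move_bead h y (move_bead h x S)))"
  define P where "P = (SIGMA x:A. movable h (move_bead h x S))"
  \<comment> \<open>\<open>P1\<close>: one bead moves twice. \<open>P2\<close>: the second bead
    takes the place left by the first. \<open>P3\<close>: two moves that are possible in either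
    order.\<close>
  define P1 where "P1 = {(x, y). y = x - h \<and> x \<in> S \<and> x - h \<notin> S \<and> x - 2 * h \<notin> S}"
  define P2 where "P2 = {(x, y). x = y - h \<and> y \<in> S \<and> y - h \<in> S \<and> y - 2 * h \<notin> S}"
  define P3 where "P3 = {(x, y). x \<in> A \<and> y \<in> A \<and> x \<noteq> y}"
  \<comment> \<open>Moves by \<open>2 * h\<close> are split by whether the place jumped over is
    free, matching \<open>P1\<close>, or occupied, matching \<open>P2\<close>.\<close>
  define M1 where "M1 = {x \<in> S. x - 2 * h \<notin> S \<and> x - h \<notin> S}"
  define M2 where "M2 = {x \<in> S. x - 2 * h \<notin> S \<and> x - h \<in> S}"
  have finA: "finite A" unfolding A_def by (rule finite_movable[OF S])
  have finP: "finite P"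
    unfolding P_def by (intro finite_SigmaI finA finite_movable maya_move_bead S)
  have M: "movable (2 * h) S = M1 \<union> M2" "M1 \<inter> M2 = {}"
    by (auto simp: movable_def M1_def M2_def)
  have finM: "finite M1" "finite M2"
    using finite_movable[OF S, of "2 * h"] M(1) by auto
  have P_iff: "(x, y) \<in> P \<longleftrightarrow> (x, y) \<in> P1 \<union> P2 \<union> P3" for x y
  proof -
    have "y - h - h = y - 2 * h" "x - h - h = x - 2 * h" by auto
    then show ?thesis
      using h by (auto simp: P_def P1_def P2_def P3_def A_def movable_def move_bead_def)
  qed
  have PU: "P = P1 \<union> P2 \<union> P3" using P_iff by auto
  have disj: "(P1 \<union> P2) \<inter> P3 = {}" "P1 \<inter> P2 = {}"
    using h by (auto simp: P1_def P2_def P3_def A_def movable_def)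
  have fins: "finite P1" "finite P2" "finite P3" using finP PU by auto
  have "bead_step h (bead_step h \<phi>) S = (\<Sum>(x, y)\<in>P. F x y)"
    unfolding bead_step_def P_def A_def F_def
    by (subst sum.Sigma) (auto intro!: finite_movable maya_move_bead S)
  also have "\<dots> = (\<Sum>(x, y)\<in>P1. F x y) + (\<Sum>(x, y)\<in>P2. F x y) + (\<Sum>(x, y)\<in>P3. F x y)"
    using fins disj by (simp add: PU sum.union_disjoint)
  also have "(\<Sum>(x, y)\<in>P3. F x y) = 0"
  proof -
    \<comment> \<open>\<open>G\<close> agrees with \<open>F\<close> on \<open>P3\<close> but is
      symmetric for all arguments, as the cancellation requires.\<close>
    define G where "G = (\<lambda>x y. \<phi> (insert (x - h) (insert (y - h) (S - {x, y}))))"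
    have "(\<Sum>(x, y)\<in>P3. F x y) = (\<Sum>(x, y)\<in>P3. G x y)"
    proof (intro sum.cong refl, clarify)
      fix x y assume "(x, y) \<in> P3"
      then have "move_bead h y (move_bead h x S) = insert (x - h) (insert (y - h) (S - {x, y}))"
        by (auto simp: P3_def A_def movable_def move_bead_def)
      then show "F x y = G x y" by (simp add: F_def G_def)
    qed
    also have "\<dots> = 0" unfolding P3_def
      by (rule sum_symmetric_pairs_bit[OF finA]) (simp add: G_def insert_commute)
    finally show ?thesis .
  qed
  also have "(\<Sum>(x, y)\<in>P1. F x y) = (\<Sum>x\<in>M1. \<phi> (move_bead (2 * h) x S))"
  proof (rule sum.reindex_bij_witness[of _ "\<lambda>x. (x, x - h)" fst])
    fix p assume "p \<in> P1"
    then obtain x where x: "p = (x, x - h)" "x \<in> S" "x - h \<notin> S" by (auto simp: P1_def)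
    have "move_bead h (x - h) (move_bead h x S) = move_bead (2 * h) x S"
      using x h by (auto simp: move_bead_def)
    then show "\<phi> (move_bead (2 * h) (fst p) S) = (case p of (x, y) \<Rightarrow> F x y)"
      by (simp add: x F_def)
  qed (auto simp: P1_def M1_def)
  also have "(\<Sum>(x, y)\<in>P2. F x y) = (\<Sum>x\<in>M2. \<phi> (move_bead (2 * h) x S))"
  proof (rule sum.reindex_bij_witness[of _ "\<lambda>y. (y - h, y)" snd])
    fix p assume "p \<in> P2"
    then obtain y where y: "p = (y - h, y)" "y \<in> S" "y - h \<in> S" by (auto simp: P2_def)
    \<comment> \<open>Beads are indistinguishable: shifting two adjacent beads by \<open>h\<close>
      gives the same set as lifting the upper one over the lower.\<close>
    have "move_bead h y (move_bead h (y - h) S) = move_bead (2 * h) y S"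
      using y h by (auto simp: move_bead_def)
    then show "\<phi> (move_bead (2 * h) (snd p) S) = (case p of (x, y) \<Rightarrow> F x y)"
      by (simp add: y F_def)
  qed (auto simp: P2_def M2_def)
  also have "(\<Sum>x\<in>M1. \<phi> (move_bead (2 * h) x S)) + (\<Sum>x\<in>M2. \<phi> (move_bead (2 * h) x S)) + 0
      = bead_step (2 * h) \<phi> S"
    using finM M by (simp add: bead_step_def sum.union_disjoint)
  finally show ?thesis .
qed

text \<open>Iterates of \<open>bead_step\<close> are known to agree only on Maya diagrams; this
  allows rewriting under a further \<open>bead_step\<close>.\<close>

lemma bead_step_cong:
  assumes "maya S" "\<And>S. maya S \<Longrightarrow> \<phi> S = \<psi> S"
  shows "bead_step h \<phi> S = bead_step h \<psi> S"
  unfolding bead_step_def by (intro sum.cong refl assms(2) maya_move_bead assms(1))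

text \<open>Each of the two halves of \<open>2 ^ Suc k\<close> unit steps is one move by
  \<open>2 ^ k\<close>, and \<open>bead_step_twice\<close> merges these.\<close>

lemma bead_step_power_two:
  assumes "maya S"
  shows "(bead_step 1 ^^ (2 ^ k)) \<phi> S = bead_step (2 ^ k) \<phi> S"
  using assms
proof (induction k arbitrary: \<phi> S)
  case (Suc k)
  have "(bead_step 1 ^^ (2 ^ Suc k)) \<phi> S =
      (bead_step 1 ^^ (2 ^ k)) ((bead_step 1 ^^ (2 ^ k)) \<phi>) S"
    by (simp add: mult_2 funpow_add)
  also have "\<dots> = bead_step (2 ^ k) ((bead_step 1 ^^ (2 ^ k)) \<phi>) S"
    using Suc by blast
  also have "\<dots> = bead_step (2 ^ k) (bead_step (2 ^ k) \<phi>) S"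
    using Suc by (intro bead_step_cong) auto
  also have "\<dots> = bead_step (2 ^ Suc k) \<phi> S"
    using bead_step_twice[OF Suc.prems, of "2 ^ k"] by simp
  finally show ?case .
qed simp

section \<open>Beads of a partition\<close>

text \<open>Padding with infinitely many empty rows provides the infinite supply of low beads and
  lets a row become empty without a change of indices.\<close>

definition row_function :: "(nat \<Rightarrow> nat) \<Rightarrow> bool" where
  "row_function l \<longleftrightarrow> antimono l \<and> (\<exists>m. \<forall>i\<ge>m. l i = 0)"

definition cells :: "(nat \<Rightarrow> nat) \<Rightarrow> (nat \<times> nat) set" where
  "cells l = {(i, j). j < l i}"

definition bead :: "(nat \<Rightarrow> nat) \<Rightarrow> nat \<Rightarrow> int" where
  "bead l i = int (l i) - int i"

text \<open>Indicator of the empty partition, whose row \<open>i\<close> has its bead at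
  \<open>- i\<close>.\<close>

definition ground_state :: "int set \<Rightarrow> bit" where
  "ground_state S = (if S = {..0} then 1 else 0)"

lemma finite_cells:
  assumes "row_function l"
  shows "finite (cells l)"
proof -
  obtain m where m: "\<forall>i\<ge>m. l i = 0" using assms by (auto simp: row_function_def)
  have "cells l \<subseteq> (SIGMA i:{..<m}. {..<l i})"
    using m by (force simp: cells_def not_le[symmetric])
  then show ?thesis by (rule finite_subset) auto
qed

lemma lower_diagram_cells:
  assumes "row_function l"
  shows "lower_diagram (cells l)"
proof -
  have "l (Suc i) \<le> l i" for i using assms by (auto simp: row_function_def antimono_def)
  then show ?thesis
    using finite_cells[OF assms] by (auto simp: lower_diagram_def cells_def intro: less_le_trans)
qed

lemma bead_strict_anti:
  assumes "row_function l" "i < k"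
  shows "bead l k < bead l i"
proof -
  have "l k \<le> l i" using assms by (auto simp: row_function_def antimono_def)
  then show ?thesis using assms(2) by (simp add: bead_def)
qed

lemma inj_bead:
  assumes "row_function l"
  shows "inj (bead l)"
  by (rule injI) (metis assms bead_strict_anti less_irrefl nat_neq_iff)

lemma maya_range_bead:
  assumes "row_function l"
  shows "maya (range (bead l))"
proof -
  obtain m where m: "\<forall>i\<ge>m. l i = 0" using assms by (auto simp: row_function_def)
  have "x \<in> range (bead l)" if "x \<le> - int m" for x
  proof
    show "x = bead l (nat (- x))" using m that by (simp add: bead_def)
  qed simp
  moreover have "bead l i \<le> bead l 0" for i
    using bead_strict_anti[OF assms, of 0 i] by (cases i) auto
  ultimately show ?thesis unfolding maya_def by (intro exI[of _ "- int m"] exI[of _ "bead l 0"]) auto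
qed

text \<open>Beads strictly decrease, so the place just below bead \<open>i\<close> can only be taken
  by bead \<open>Suc i\<close>, and it is taken exactly when the two rows have equal length.\<close>

lemma movable_range_bead:
  assumes l: "row_function l"
  shows "movable 1 (range (bead l)) = bead l ` {i. l (Suc i) < l i}"
proof -
  have "bead l i - 1 \<in> range (bead l) \<longleftrightarrow> \<not> l (Suc i) < l i" for i
  proof
    assume "bead l i - 1 \<in> range (bead l)"
    then obtain k where k: "bead l k = bead l i - 1" by force
    then have "\<not> k \<le> i" using bead_strict_anti[OF l, of k i] by (cases "k = i") auto
    moreover have "\<not> Suc i < k"
      using k bead_strict_anti[OF l, of i "Suc i"] bead_strict_anti[OF l, of "Suc i" k] by auto
    ultimately have "k = Suc i" by simp
    then show "\<not> l (Suc i) < l i" using k by (simp add: bead_def)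
  next
    assume "\<not> l (Suc i) < l i"
    moreover have "l (Suc i) \<le> l i" using l by (auto simp: row_function_def antimono_def)
    ultimately have "bead l (Suc i) = bead l i - 1" by (simp add: bead_def)
    then show "bead l i - 1 \<in> range (bead l)" by (metis rangeI)
  qed
  then show ?thesis by (auto simp: movable_def)
qed

lemma corners_cells: "corners (cells l) = (\<lambda>i. (i, l i - 1)) ` {i. l (Suc i) < l i}"
  by (force simp: corners_def cells_def)

lemma row_function_remove:
  assumes l: "row_function l" and i: "l (Suc i) < l i"
  shows "row_function (l(i := l i - 1))"
proof -
  have anti: "l b \<le> l a" if "a \<le> b" for a b
    using l that by (auto simp: row_function_def antimono_def)
  have "(l(i := l i - 1)) b \<le> (l(i := l i - 1)) a" if "a \<le> b" for a b
    using anti[OF that] anti[of "Suc i" b] i that by (cases "b = i"; cases "a = i") auto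
  moreover obtain m where "\<forall>i\<ge>m. l i = 0" using l by (auto simp: row_function_def)
  then have "\<forall>k\<ge>m. (l(i := l i - 1)) k = 0" by auto
  ultimately show ?thesis unfolding row_function_def antimono_def by blast
qed

lemma cells_remove:
  assumes "l (Suc i) < l i"
  shows "cells l - {(i, l i - 1)} = cells (l(i := l i - 1))"
  using assms by (auto simp: cells_def split: if_splits)

text \<open>Shortening row \<open>i\<close> lowers its bead and fixes the others; by injectivity,
  deleting the value \<open>bead l i\<close> affects no other row.\<close>

lemma range_bead_remove:
  assumes l: "row_function l" and i: "l (Suc i) < l i"
  shows "move_bead 1 (bead l i) (range (bead l)) = range (bead (l(i := l i - 1)))"
proof -
  have "range (bead l) - {bead l i} = bead l ` (UNIV - {i})"
    using inj_bead[OF l] by (auto simp: inj_def)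
  also have "\<dots> = bead (l(i := l i - 1)) ` (UNIV - {i})"
    by (intro image_cong) (auto simp: bead_def)
  finally have "move_bead 1 (bead l i) (range (bead l)) =
      insert (bead l i - 1) (bead (l(i := l i - 1)) ` (UNIV - {i}))"
    by (simp add: move_bead_def)
  also have "bead l i - 1 = bead (l(i := l i - 1)) i" using i by (simp add: bead_def)
  also have "insert \<dots> (bead (l(i := l i - 1)) ` (UNIV - {i})) = range (bead (l(i := l i - 1)))"
    by auto
  finally show ?thesis .
qed

text \<open>Corners correspond to beads movable by one, so the branching rule mod 2 is
  \<open>bead_step 1\<close>, and the recursion ends at the empty diagram.\<close>

lemma card_tableaux_mod_two:
  assumes "row_function l"
  shows "of_nat (card (diagram_tableaux (cells l))) =
    (bead_step 1 ^^ card (cells l)) ground_state (range (bead l))"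
  using assms
proof (induction "card (cells l)" arbitrary: l)
  case 0
  then have empty: "cells l = {}" using finite_cells by (metis card_0_eq)
  then have "l i = 0" for i by (auto simp: cells_def)
  then have "bead l i = - int i" for i by (simp add: bead_def)
  then have "range (bead l) = {..0}"
    by (auto intro!: image_eqI[of _ _ "nat (- x)" for x])
  then show ?case by (simp add: empty diagram_tableaux_empty ground_state_def)
next
  case (Suc n)
  note l = \<open>row_function l\<close>
  let ?I = "{i. l (Suc i) < l i}"
  have ne: "cells l \<noteq> {}" using Suc by auto
  have n: "card (cells (l(i := l i - 1))) = n" if "i \<in> ?I" for i
  proof -
    have "(i, l i - 1) \<in> cells l" using that by (auto simp: cells_def)
    then have "card (cells l - {(i, l i - 1)}) = n"
      using Suc(2) finite_cells[OF l] by simp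
    then show ?thesis using that cells_remove[of l i] by simp
  qed
  have inj: "inj_on (bead l) ?I" using inj_bead[OF l] by (rule inj_on_subset) simp
  have "of_nat (card (diagram_tableaux (cells l))) =
      (\<Sum>i\<in>?I. of_nat (card (diagram_tableaux (cells l - {(i, l i - 1)}))) :: bit)"
    unfolding card_diagram_tableaux[OF lower_diagram_cells[OF l] ne] corners_cells
    by (subst sum.reindex) (auto simp: inj_on_def)
  also have "\<dots> = (\<Sum>i\<in>?I. (bead_step 1 ^^ n) ground_state (move_bead 1 (bead l i) (range (bead l))))"
  proof (intro sum.cong refl)
    fix i assume i: "i \<in> ?I"
    then have "cells l - {(i, l i - 1)} = cells (l(i := l i - 1))"
      by (simp only: cells_remove mem_Collect_eq)
    then show "of_nat (card (diagram_tableaux (cells l - {(i, l i - 1)}))) =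
        (bead_step 1 ^^ n) ground_state (move_bead 1 (bead l i) (range (bead l)))"
      using Suc(1)[OF n[OF i, symmetric] row_function_remove[OF l]] n[OF i] i
      by (simp add: range_bead_remove[OF l])
  qed
  also have "\<dots> = bead_step 1 ((bead_step 1 ^^ n) ground_state) (range (bead l))"
    unfolding bead_step_def movable_range_bead[OF l] by (simp add: sum.reindex[OF inj])
  finally show ?case by (simp add: Suc(2)[symmetric])
qed

section \<open>Odd diagrams with \<open>2 ^ k\<close> and \<open>2 ^ k + 1\<close> cells\<close>

lemma bead_step_nonzeroE:
  assumes "bead_step h \<phi> S \<noteq> 0"
  obtains x where "x \<in> S" "x - h \<notin> S" "\<phi> (move_bead h x S) \<noteq> 0"
  using assms sum.not_neutral_contains_not_neutral[of "\<lambda>x. \<phi> (move_bead h x S)" "movable h S"]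
  by (auto simp: bead_step_def movable_def)

lemma odd_of_nat_bit:
  assumes "odd n"
  shows "(of_nat n :: bit) \<noteq> 0"
  using assms by (auto elim!: oddE)

text \<open>A single move by \<open>2 ^ k\<close> must reach \<open>{..0}\<close>, so at most one
  bead is positive; the cell \<open>(1, 1)\<close> would make the first two positive.\<close>

lemma odd_power_two_cells:
  assumes l: "row_function l" and card: "card (cells l) = 2 ^ k"
    and odd: "odd (card (diagram_tableaux (cells l)))"
  shows "(1, 1) \<notin> cells l"
proof
  let ?S = "range (bead l)"
  assume "(1, 1) \<in> cells l"
  then have pos: "bead l 1 > 0" by (simp add: cells_def bead_def)
  then have pos0: "bead l 0 > bead l 1" using bead_strict_anti[OF l, of 0 1] by simp
  have "bead_step (2 ^ k) ground_state ?S \<noteq> 0"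
    using odd_of_nat_bit[OF odd] card_tableaux_mod_two[OF l]
    by (simp add: card bead_step_power_two maya_range_bead[OF l])
  then obtain x where "ground_state (move_bead (2 ^ k) x ?S) \<noteq> 0" by (rule bead_step_nonzeroE)
  then have "move_bead (2 ^ k) x ?S = {..0}" by (simp add: ground_state_def split: if_splits)
  then have "y \<notin> move_bead (2 ^ k) x ?S" if "y > 0" for y using that by simp
  then have "y = x" if "y \<in> ?S" "y > 0" for y
    using that unfolding move_bead_def by blast
  from this[of "bead l 0"] this[of "bead l 1"] show False using pos pos0 by simp
qed

text \<open>Before the last unit move, place 0 is free and no bead lies above 1. A hook with both an
  arm and a leg has a bead at 0 and one above 1, and the one long move cannot displace both.\<close>

lemma odd_power_two_plus_one_cells:
  assumes l: "row_function l" and card: "card (cells l) = 2 ^ k + 1"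
    and odd: "odd (card (diagram_tableaux (cells l)))"
  shows "(1, 1) \<in> cells l \<or> (0, 1) \<notin> cells l \<or> (1, 0) \<notin> cells l"
proof (rule ccontr)
  let ?S = "range (bead l)"
  assume "\<not> ?thesis"
  then have l01: "l 1 = 1" "l 0 \<ge> 2" by (auto simp: cells_def)
  \<comment> \<open>The outer operator moves the configuration first: the long move precedes the
    unit move.\<close>
  have "bead_step (2 ^ k) (bead_step 1 ground_state) ?S \<noteq> 0"
    using odd_of_nat_bit[OF odd] card_tableaux_mod_two[OF l]
    by (simp add: card funpow_Suc_right bead_step_power_two maya_range_bead[OF l] del: funpow.simps)
  then obtain x where x: "bead_step 1 ground_state (move_bead (2 ^ k) x ?S) \<noteq> 0"
    by (rule bead_step_nonzeroE)
  define S' where "S' = move_bead (2 ^ k) x ?S"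
  obtain y where y: "y \<in> S'" "y - 1 \<notin> S'" "ground_state (move_bead 1 y S') \<noteq> 0"
    using x unfolding S'_def by (rule bead_step_nonzeroE)
  then have ground: "move_bead 1 y S' = {..0}" by (simp add: ground_state_def split: if_splits)
  \<comment> \<open>The last move enters \<open>{..0}\<close> from outside by one place, so it
    starts at 1.\<close>
  have "y - 1 \<in> {..0}" "y \<notin> {..0}"
    unfolding ground[symmetric] by (simp_all add: move_bead_def)
  then have "y = 1" by simp
  then have no0: "0 \<notin> S'" using y by simp
  have le1: "z \<le> 1" if "z \<in> S'" for z
  proof (cases "z = y")
    case False
    then have "z \<in> {..0}" unfolding ground[symmetric] using that by (simp add: move_bead_def)
    then show ?thesis by simp
  qed (simp add: \<open>y = 1\<close>)
  \<comment> \<open>Such a bead is missing from \<open>S'\<close>, hence it is the one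
    moved.\<close>
  have "z = x" if "z \<in> ?S" "z = 0 \<or> z > 1" for z
  proof -
    have "z \<notin> S'" using that(2) no0 le1[of z] by auto
    then show ?thesis using that(1) unfolding S'_def move_bead_def by blast
  qed
  moreover have "bead l 1 = 0" "bead l 0 > 1" using l01 by (simp_all add: bead_def)
  ultimately have "bead l 0 = x" "bead l 1 = x" by blast+
  then show False using bead_strict_anti[OF l, of 0 1] by simp
qed

section \<open>Rays\<close>

definition rows :: "nat list \<Rightarrow> nat \<Rightarrow> nat" where
  "rows \<mu> i = (if i < length \<mu> then \<mu> ! i else 0)"

lemma row_function_rows:
  assumes "is_partition \<mu>"
  shows "row_function (rows \<mu>)"
proof -
  have "\<mu> ! b \<le> \<mu> ! a" if "a \<le> b" "b < length \<mu>" for a b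
    using assms that by (cases "a = b") (auto simp: is_partition_def sorted_wrt_iff_nth_less)
  then show ?thesis
    by (auto simp: row_function_def antimono_def rows_def intro!: exI[of _ "length \<mu>"])
qed

lemma cells_rows: "cells (rows \<mu>) = young_diagram \<mu>"
  by (auto simp: cells_def rows_def young_diagram_def split: if_splits)

lemma card_young_diagram: "card (young_diagram \<mu>) = sum_list \<mu>"
proof -
  have "young_diagram \<mu> = (SIGMA i:{..<length \<mu>}. {..<\<mu> ! i})"
    by (auto simp: young_diagram_def)
  then show ?thesis by (simp add: sum_list_sum_nth atLeast0LessThan)
qed

lemma num_syt_eq: "num_syt \<mu> = card (diagram_tableaux (young_diagram \<mu>))"
  by (simp add: num_syt_def standard_tableaux_def diagram_tableaux_def card_young_diagram)

section \<open>One-row and one-column partitions form rays\<close>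

lemma is_partition_one_row: "is_partition (one_row n)"
  by (simp add: is_partition_def one_row_def)

lemma is_partition_one_column: "is_partition (one_column n)"
  by (auto simp: is_partition_def one_column_def sorted_wrt_iff_nth_less)

lemma young_diagram_one_row: "young_diagram (one_row n) = {0} \<times> {..<n}"
  by (auto simp: young_diagram_def one_row_def)

lemma young_diagram_one_column: "young_diagram (one_column n) = {..<n} \<times> {0}"
  by (auto simp: young_diagram_def one_column_def)

lemma num_syt_one_row: "num_syt (one_row n) = 1"
proof (induction n)
  case 0
  show ?case by (simp add: num_syt_eq young_diagram_one_row diagram_tableaux_empty)
next
  case (Suc n)
  have "corners ({0} \<times> {..<Suc n}) = {(0, n)}" by (auto simp: corners_def)
  moreover have "lower_diagram ({0} \<times> {..<Suc n})" by (auto simp: lower_diagram_def)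
  moreover have "{0} \<times> {..<Suc n} - {(0, n)} = {0 :: nat} \<times> {..<n}" by auto
  ultimately show ?case
    using Suc card_diagram_tableaux[of "{0} \<times> {..<Suc n}"]
    by (auto simp: num_syt_eq young_diagram_one_row)
qed

lemma num_syt_one_column: "num_syt (one_column n) = 1"
proof (induction n)
  case 0
  show ?case by (simp add: num_syt_eq young_diagram_one_column diagram_tableaux_empty)
next
  case (Suc n)
  have "corners ({..<Suc n} \<times> {0}) = {(n, 0)}" by (auto simp: corners_def)
  moreover have "lower_diagram ({..<Suc n} \<times> {0})" by (auto simp: lower_diagram_def)
  moreover have "{..<Suc n} \<times> {0} - {(n, 0)} = {..<n} \<times> {0 :: nat}" by auto
  ultimately show ?case
    using Suc card_diagram_tableaux[of "{..<Suc n} \<times> {0}"]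
    by (auto simp: num_syt_eq young_diagram_one_column)
qed

lemma macdonald_ray_one_row: "macdonald_ray one_row"
proof -
  have "young_covers (one_row (Suc n)) (one_row n)" for n
    unfolding young_covers_def
    by (intro conjI is_partition_one_row exI[of _ "(0, n)"]) (auto simp: young_diagram_one_row)
  then show ?thesis
    by (simp add: macdonald_ray_def odd_partition_def is_partition_one_row num_syt_one_row)
       (simp add: one_row_def)
qed

lemma macdonald_ray_one_column: "macdonald_ray one_column"
proof -
  have "young_covers (one_column (Suc n)) (one_column n)" for n
    unfolding young_covers_def
    by (intro conjI is_partition_one_column exI[of _ "(n, 0)"]) (auto simp: young_diagram_one_column)
  then show ?thesis
    by (simp add: macdonald_ray_def odd_partition_def is_partition_one_column num_syt_one_column)
       (simp add: one_column_def)
qed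

section \<open>Uniqueness of the two rays\<close>

lemma partition_eq_one_row:
  assumes "is_partition \<mu>" "(1, 0) \<notin> young_diagram \<mu>"
  shows "\<mu> = one_row (card (young_diagram \<mu>))"
proof -
  have "length \<mu> \<le> 1"
  proof (rule ccontr)
    assume "\<not> length \<mu> \<le> 1"
    then have "\<mu> ! 1 > 0" using assms(1) by (simp add: is_partition_def)
    then show False using assms(2) \<open>\<not> length \<mu> \<le> 1\<close> by (simp add: young_diagram_def)
  qed
  then show ?thesis
    using assms(1) unfolding card_young_diagram
    by (cases \<mu>) (auto simp: one_row_def is_partition_def)
qed

lemma partition_eq_one_column:
  assumes p: "is_partition \<mu>" and no: "(0, 1) \<notin> young_diagram \<mu>"
  shows "\<mu> = one_column (card (young_diagram \<mu>))"
proof -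
  have "\<mu> ! i = 1" if i: "i < length \<mu>" for i
  proof -
    have "\<mu> ! 0 \<le> 1" using no i by (cases \<mu>) (simp_all add: young_diagram_def)
    moreover have "\<mu> ! i \<le> \<mu> ! 0"
      using p i by (cases "i = 0") (auto simp: is_partition_def sorted_wrt_iff_nth_less)
    moreover have "\<mu> ! i > 0" using p i by (simp add: is_partition_def)
    ultimately show ?thesis by simp
  qed
  then have eq: "\<mu> = replicate (length \<mu>) 1" by (intro nth_equalityI) auto
  moreover have "sum_list \<mu> = length \<mu>" by (subst eq) (simp add: sum_list_replicate)
  ultimately show ?thesis by (simp add: card_young_diagram one_column_def)
qed

lemma macdonald_ray_cases:
  assumes r: "macdonald_ray r"
  shows "r = one_row \<or> r = one_column"
proof -
  define Y where "Y = (\<lambda>n. young_diagram (r n))"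
  have part: "is_partition (r n)" and odd: "odd (card (diagram_tableaux (Y n)))" for n
    using r by (simp_all add: macdonald_ray_def odd_partition_def Y_def flip: num_syt_eq)
  have l: "row_function (rows (r n))" for n by (rule row_function_rows[OF part])
  have step: "\<exists>c. c \<notin> Y n \<and> Y (Suc n) = insert c (Y n)" for n
    using r by (simp add: macdonald_ray_def young_covers_def Y_def)
  have finY: "finite (Y n)" for n using finite_cells[OF l] by (simp add: Y_def cells_rows)
  have cardY: "card (Y n) = n" for n
  proof (induction n)
    case 0
    show ?case using r by (simp add: Y_def macdonald_ray_def card_young_diagram)
  next
    case (Suc n)
    then show ?case using step[of n] finY[of n] by auto
  qed
  have "Y n \<subseteq> Y (Suc n)" for n using step[of n] by auto
  then have mono: "Y m \<subseteq> Y n" if "m \<le> n" for m n using lift_Suc_mono_le that by blast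
  have large: "n \<le> 2 ^ n" for n :: nat using less_exp[of n] by simp
  \<comment> \<open>A cell \<open>(1, 1)\<close> of \<open>Y n\<close> would persist in the odd
    diagram \<open>Y (2 ^ n)\<close>.\<close>
  have no11: "(1, 1) \<notin> Y n" for n
    using odd_power_two_cells[OF l, of "2 ^ n" n] odd cardY mono[OF large[of n]]
    by (auto simp: cells_rows Y_def)
  have "(0, 1) \<notin> Y n \<or> (1, 0) \<notin> Y n" for n
  proof -
    have "n \<le> 2 ^ n + 1" using large[of n] by (rule trans_le_add1)
    from mono[OF this] show ?thesis
      using odd_power_two_plus_one_cells[OF l, of "2 ^ n + 1" n] odd cardY no11
      by (auto simp: cells_rows Y_def)
  qed
  \<comment> \<open>If the two cells occurred at different times, both would lie in the diagram at
    the later time.\<close>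
  then have "(\<forall>n. (1, 0) \<notin> Y n) \<or> (\<forall>n. (0, 1) \<notin> Y n)"
    by (meson mono max.cobounded1 max.cobounded2 subsetD)
  then show ?thesis
  proof
    assume "\<forall>n. (1, 0) \<notin> Y n"
    then have "r n = one_row n" for n
      using partition_eq_one_row[OF part, of n] cardY[of n] by (simp add: Y_def)
    then show ?thesis by blast
  next
    assume "\<forall>n. (0, 1) \<notin> Y n"
    then have "r n = one_column n" for n
      using partition_eq_one_column[OF part, of n] cardY[of n] by (simp add: Y_def)
    then show ?thesis by blast
  qed
qed

theorem theorem3p5:
  shows "{r. macdonald_ray r} = {one_row, one_column}"
  using macdonald_ray_cases macdonald_ray_one_row macdonald_ray_one_column by auto

end
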